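(* Let $G$ and $H$ be countable, discrete, sofic groups. Then the wreath product $G\wr H$ is sofic.
   Context: The (restricted, regular) wreath product is $G\wr H=\left(\bigoplus_{H}G\right)\rtimes H$, where $h\in H$ acts on $\bigoplus_H G$ by the coordinate shift $\alpha_h\big((g_x)_{x\in H}\big)=(g_{h^{-1}x})_{x\in H}$. For a finite set $A$, the normalized Hamming distance on $\mathrm{Sym}(A)$ is $d_{\mathrm{Hamm}}(\pi,\tau)=\frac{1}{|A|}|\{a\in A:\pi(a)\neq\tau(a)\}|$, and $\ell_{\mathrm{Hamm}}(\pi)=d_{\mathrm{Hamm}}(\pi,1)$. Let $G$ be a countable discrete group, $F\subseteq G$ finite and $\varepsilon>0$. A function $\sigma\colon G\to\mathrm{Sym}(A)$ (not necessarily a homomorphism) is an $(F,\varepsilon)$-sofic approximation if $\sigma(1)=1$, $\max_{g,h\in F}d_{\mathrm{Hamm}}(\sigma(gh),\sigma(g)\sigma(h))<\varepsilon$, and $\min_{g\in F\setminus\{1\}}\ell_{\mathrm{Hamm}}(\sigma(g))>1-\varepsilon$. The group $G$ is sofic if for every finite $F\subseteq G$ and every $\varepsilon>0$ there are a finite set $A$ and an $(F,\varepsilon)$-sofic approximation $\sigma\colon G\to\mathrm{Sym}(A)$. *)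

theory Defs
  imports "HOL-Algebra.Algebra" "HOL-Library.Countable_Set"
begin

section \<open>Wreath products\<close>

definition semidirect_product ::
  "('n, 'p) monoid_scheme \<Rightarrow> ('h, 'q) monoid_scheme \<Rightarrow> ('h \<Rightarrow> 'n \<Rightarrow> 'n) \<Rightarrow> ('n \<times> 'h) monoid"
  where "semidirect_product N H \<alpha> =
    \<lparr>carrier = carrier N \<times> carrier H,
     monoid.mult = \<lambda>(m, h) (n, k). (m \<otimes>\<^bsub>N\<^esub> \<alpha> h n, h \<otimes>\<^bsub>H\<^esub> k),
     monoid.one = (\<one>\<^bsub>N\<^esub>, \<one>\<^bsub>H\<^esub>)\<rparr>"

text \<open>The restrictions make each shift an element of the library's \<^const>\<open>AutoGroup\<close>,
  whose members are extensional; likewise the elements of a \<^const>\<open>sum_group\<close>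
  are extensional functions of finite support.\<close>

abbreviation wreath_base ::
  "('g, 'p) monoid_scheme \<Rightarrow> ('h, 'q) monoid_scheme \<Rightarrow> ('h \<Rightarrow> 'g) monoid"
  where "wreath_base G H \<equiv> sum_group (carrier H) (\<lambda>_. G)"

definition wreath_shift ::
  "('g, 'p) monoid_scheme \<Rightarrow> ('h, 'q) monoid_scheme \<Rightarrow> 'h \<Rightarrow> ('h \<Rightarrow> 'g) \<Rightarrow> ('h \<Rightarrow> 'g)"
  where "wreath_shift G H h =
    (\<lambda>g \<in> carrier (wreath_base G H). \<lambda>x \<in> carrier H. g (inv\<^bsub>H\<^esub> h \<otimes>\<^bsub>H\<^esub> x))"

definition wreath_product ::
  "('g, 'p) monoid_scheme \<Rightarrow> ('h, 'q) monoid_scheme \<Rightarrow> (('h \<Rightarrow> 'g) \<times> 'h) monoid"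
  where "wreath_product G H = semidirect_product (wreath_base G H) H (wreath_shift G H)"


section \<open>Sofic groups\<close>

definition hamming_dist :: "'a set \<Rightarrow> ('a \<Rightarrow> 'a) \<Rightarrow> ('a \<Rightarrow> 'a) \<Rightarrow> real"
  where "hamming_dist A \<pi> \<tau> = real (card {a \<in> A. \<pi> a \<noteq> \<tau> a}) / real (card A)"

definition hamming_length :: "'a set \<Rightarrow> ('a \<Rightarrow> 'a) \<Rightarrow> real"
  where "hamming_length A \<pi> = hamming_dist A \<pi> \<one>\<^bsub>BijGroup A\<^esub>"

text \<open>The conditions on the maximum and the minimum are spelled out elementwise, so that they
  are vacuous when these range over the empty set. \<^term>\<open>A\<close> is required to be nonempty
  because the normalized Hamming distance is only meaningful then.\<close>

definition sofic_approximation ::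
  "('g, 'p) monoid_scheme \<Rightarrow> 'g set \<Rightarrow> real \<Rightarrow> 'a set \<Rightarrow> ('g \<Rightarrow> 'a \<Rightarrow> 'a) \<Rightarrow> bool"
  where "sofic_approximation G F \<epsilon> A \<sigma> \<longleftrightarrow>
    finite A \<and> A \<noteq> {} \<and>
    \<sigma> \<in> carrier G \<rightarrow> carrier (BijGroup A) \<and>
    \<sigma> \<one>\<^bsub>G\<^esub> = \<one>\<^bsub>BijGroup A\<^esub> \<and>
    (\<forall>g\<in>F. \<forall>h\<in>F. hamming_dist A (\<sigma> (g \<otimes>\<^bsub>G\<^esub> h)) (\<sigma> g \<otimes>\<^bsub>BijGroup A\<^esub> \<sigma> h) < \<epsilon>) \<and>
    (\<forall>g\<in>F - {\<one>\<^bsub>G\<^esub>}. hamming_length A (\<sigma> g) > 1 - \<epsilon>)"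

text \<open>A definition cannot quantify over types, so the finite sets \<^term>\<open>A\<close> are taken to be sets
  of natural numbers; lemma \<open>sofic_approximation_nat\<close> shows that this loses nothing.\<close>

definition sofic :: "('g, 'p) monoid_scheme \<Rightarrow> bool"
  where "sofic G \<longleftrightarrow>
    (\<forall>F \<epsilon>. finite F \<and> F \<subseteq> carrier G \<and> \<epsilon> > 0 \<longrightarrow>
      (\<exists>(A :: nat set) \<sigma>. sofic_approximation G F \<epsilon> A \<sigma>))"


section \<open>Basic facts\<close>

lemma group_semidirect_product:
  assumes N: "group N" and H: "group H" and \<alpha>: "\<alpha> \<in> hom H (AutoGroup N)"
  shows "group (semidirect_product N H \<alpha>)"
proof -
  interpret N: group N by (fact N)
  interpret H: group H by (fact H)
  have aut: "\<alpha> h \<in> auto N" if "h \<in> carrier H" for h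
    using \<alpha> that by (auto simp: hom_def AutoGroup_def)
  have hm: "\<alpha> h \<in> hom N N" if "h \<in> carrier H" for h
    using aut[OF that] by (simp add: auto_def)
  have cl: "\<alpha> h n \<in> carrier N" if "h \<in> carrier H" "n \<in> carrier N" for h n
    using hm[OF that(1)] that(2) by (auto simp: hom_def)
  have ml: "\<alpha> h (m \<otimes>\<^bsub>N\<^esub> n) = \<alpha> h m \<otimes>\<^bsub>N\<^esub> \<alpha> h n"
    if "h \<in> carrier H" "m \<in> carrier N" "n \<in> carrier N" for h m n
    using hom_mult[OF hm] that by blast
  have comp: "\<alpha> (h \<otimes>\<^bsub>H\<^esub> k) n = \<alpha> h (\<alpha> k n)"
    if "h \<in> carrier H" "k \<in> carrier H" "n \<in> carrier N" for h k n
  proof -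
    have "\<alpha> (h \<otimes>\<^bsub>H\<^esub> k) = \<alpha> h \<otimes>\<^bsub>AutoGroup N\<^esub> \<alpha> k"
      using \<alpha> that by (simp add: hom_def)
    also have "\<dots> = compose (carrier N) (\<alpha> h) (\<alpha> k)"
      using aut that by (simp add: AutoGroup_def BijGroup_def auto_def)
    finally show ?thesis using that by (simp add: compose_def)
  qed
  have one: "\<alpha> \<one>\<^bsub>H\<^esub> n = n" if n: "n \<in> carrier N" for n
  proof -
    have "\<alpha> \<one>\<^bsub>H\<^esub> (\<alpha> \<one>\<^bsub>H\<^esub> n) = \<alpha> \<one>\<^bsub>H\<^esub> n"
      using comp[of "\<one>\<^bsub>H\<^esub>" "\<one>\<^bsub>H\<^esub>" n] n by simp
    moreover have "inj_on (\<alpha> \<one>\<^bsub>H\<^esub>) (carrier N)"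
      using aut by (auto simp: auto_def Bij_def bij_betw_def)
    ultimately show ?thesis using cl n by (meson H.one_closed inj_onD)
  qed
  have hone: "\<alpha> h \<one>\<^bsub>N\<^esub> = \<one>\<^bsub>N\<^esub>" if "h \<in> carrier H" for h
    using hom_one[OF hm[OF that] N N] .
  show ?thesis
  proof (rule groupI, goal_cases)
    case (5 x)
    then obtain n h where x: "x = (n, h)" "n \<in> carrier N" "h \<in> carrier H"
      by (auto simp: semidirect_product_def)
    let ?y = "(\<alpha> (inv\<^bsub>H\<^esub> h) (inv\<^bsub>N\<^esub> n), inv\<^bsub>H\<^esub> h)"
    have "?y \<in> carrier (semidirect_product N H \<alpha>)"
      using x cl by (simp add: semidirect_product_def)
    moreover have "?y \<otimes>\<^bsub>semidirect_product N H \<alpha>\<^esub> x = \<one>\<^bsub>semidirect_product N H \<alpha>\<^esub>"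
      using x hone by (simp add: semidirect_product_def flip: ml)
    ultimately show ?case by blast
  qed (auto simp: semidirect_product_def cl ml comp one N.m_assoc H.m_assoc)
qed

lemma wreath_shift_hom:
  assumes G: "group G" and H: "group H"
  shows "wreath_shift G H \<in> hom H (AutoGroup (wreath_base G H))"
proof -
  interpret G: group G by (fact G)
  interpret H: group H by (fact H)
  let ?B = "wreath_base G H"
  have B: "carrier ?B = {x \<in> carrier H \<rightarrow>\<^sub>E carrier G. finite {i \<in> carrier H. x i \<noteq> \<one>\<^bsub>G\<^esub>}}"
    using G by (simp add: carrier_sum_group)
  have cl: "wreath_shift G H h g \<in> carrier ?B" if h: "h \<in> carrier H" and g: "g \<in> carrier ?B" for h g
  proof -
    have "{i \<in> carrier H. g (inv\<^bsub>H\<^esub> h \<otimes>\<^bsub>H\<^esub> i) \<noteq> \<one>\<^bsub>G\<^esub>}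
      \<subseteq> (\<lambda>x. h \<otimes>\<^bsub>H\<^esub> x) ` {i \<in> carrier H. g i \<noteq> \<one>\<^bsub>G\<^esub>}"
    proof
      fix i assume i: "i \<in> {i \<in> carrier H. g (inv\<^bsub>H\<^esub> h \<otimes>\<^bsub>H\<^esub> i) \<noteq> \<one>\<^bsub>G\<^esub>}"
      then have "i = h \<otimes>\<^bsub>H\<^esub> (inv\<^bsub>H\<^esub> h \<otimes>\<^bsub>H\<^esub> i)"
        using h by (simp flip: H.m_assoc)
      then show "i \<in> (\<lambda>x. h \<otimes>\<^bsub>H\<^esub> x) ` {i \<in> carrier H. g i \<noteq> \<one>\<^bsub>G\<^esub>}"
        using i h by (intro image_eqI[where x = "inv\<^bsub>H\<^esub> h \<otimes>\<^bsub>H\<^esub> i"]) auto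
    qed
    moreover have "finite {i \<in> carrier H. g i \<noteq> \<one>\<^bsub>G\<^esub>}" using g B by auto
    ultimately have "finite {i \<in> carrier H. g (inv\<^bsub>H\<^esub> h \<otimes>\<^bsub>H\<^esub> i) \<noteq> \<one>\<^bsub>G\<^esub>}"
      by (meson finite_imageI finite_subset)
    then show ?thesis
      using g h by (auto simp: wreath_shift_def B PiE_iff cong: conj_cong)
  qed
  have comp: "wreath_shift G H (h \<otimes>\<^bsub>H\<^esub> k) g = wreath_shift G H h (wreath_shift G H k g)"
    if h: "h \<in> carrier H" and k: "k \<in> carrier H" and g: "g \<in> carrier ?B" for h k g
    using h k g cl[OF k g]
    by (auto simp: wreath_shift_def H.inv_mult_group H.m_assoc intro!: restrict_ext)
  have one: "wreath_shift G H \<one>\<^bsub>H\<^esub> g = g" if g: "g \<in> carrier ?B" for g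
    using g by (auto simp: wreath_shift_def B PiE_iff extensional_def fun_eq_iff)
  have bij: "wreath_shift G H h \<in> Bij (carrier ?B)" if h: "h \<in> carrier H" for h
  proof -
    have "bij_betw (wreath_shift G H h) (carrier ?B) (carrier ?B)"
    proof (rule bij_betw_byWitness[where f' = "wreath_shift G H (inv\<^bsub>H\<^esub> h)"])
      show "\<forall>g\<in>carrier ?B. wreath_shift G H (inv\<^bsub>H\<^esub> h) (wreath_shift G H h g) = g"
        using h one by (simp flip: comp)
      show "\<forall>g\<in>carrier ?B. wreath_shift G H h (wreath_shift G H (inv\<^bsub>H\<^esub> h) g) = g"
        using h one by (simp flip: comp)
    qed (use h cl in auto)
    then show ?thesis by (simp add: Bij_def wreath_shift_def)
  qed
  have ml: "wreath_shift G H h (f \<otimes>\<^bsub>?B\<^esub> g) = wreath_shift G H h f \<otimes>\<^bsub>?B\<^esub> wreath_shift G H h g"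
    if h: "h \<in> carrier H" and f: "f \<in> carrier ?B" and g: "g \<in> carrier ?B" for h f g
  proof -
    have "f \<otimes>\<^bsub>?B\<^esub> g \<in> carrier ?B"
      using sum_group[of "carrier H" "\<lambda>_. G"] G f g
      by (meson group.is_monoid monoid.m_closed)
    then show ?thesis
      using h f g by (auto simp: wreath_shift_def intro!: restrict_ext)
  qed
  have aut: "wreath_shift G H h \<in> auto ?B" if "h \<in> carrier H" for h
    using that bij cl ml by (auto simp: auto_def hom_def simp del: mult_sum_group)
  show ?thesis
  proof (rule homI)
    fix h k assume hk: "h \<in> carrier H" "k \<in> carrier H"
    have "wreath_shift G H (h \<otimes>\<^bsub>H\<^esub> k) =
      compose (carrier ?B) (wreath_shift G H h) (wreath_shift G H k)"
    proof (rule extensionalityI)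
      show "wreath_shift G H (h \<otimes>\<^bsub>H\<^esub> k) \<in> extensional (carrier ?B)"
        by (simp add: wreath_shift_def)
    qed (use hk comp in \<open>auto simp: compose_def\<close>)
    then show "wreath_shift G H (h \<otimes>\<^bsub>H\<^esub> k) =
      wreath_shift G H h \<otimes>\<^bsub>AutoGroup ?B\<^esub> wreath_shift G H k"
      using hk bij by (simp add: AutoGroup_def BijGroup_def)
  qed (simp add: AutoGroup_def aut)
qed

lemma group_wreath_product:
  assumes "group G" and "group H"
  shows "group (wreath_product G H)"
  unfolding wreath_product_def
  using assms by (intro group_semidirect_product wreath_shift_hom sum_group)

lemma countable_wreath_product:
  assumes G: "group G" and cG: "countable (carrier G)" and cH: "countable (carrier H)"
  shows "countable (carrier (wreath_product G H))"
proof -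
  let ?B = "carrier (wreath_base G H)"
  let ?\<Phi> = "\<lambda>f. (\<lambda>i. (i, f i)) ` {i \<in> carrier H. f i \<noteq> \<one>\<^bsub>G\<^esub>}"
  have B: "?B = {x \<in> carrier H \<rightarrow>\<^sub>E carrier G. finite {i \<in> carrier H. x i \<noteq> \<one>\<^bsub>G\<^esub>}}"
    using G by (simp add: carrier_sum_group)
  have "inj_on ?\<Phi> ?B"
  proof (rule inj_onI)
    fix f g assume f: "f \<in> ?B" and g: "g \<in> ?B" and eq: "?\<Phi> f = ?\<Phi> g"
    have "f i = g i" if i: "i \<in> carrier H" for i
    proof -
      have "(i, f i) \<in> ?\<Phi> g" if "f i \<noteq> \<one>\<^bsub>G\<^esub>" using that i by (auto simp flip: eq)
      moreover have "(i, g i) \<in> ?\<Phi> f" if "g i \<noteq> \<one>\<^bsub>G\<^esub>" using that i by (auto simp: eq)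
      ultimately show ?thesis by (cases "f i = \<one>\<^bsub>G\<^esub>"; cases "g i = \<one>\<^bsub>G\<^esub>") auto
    qed
    then show "f = g" using f g B by (auto intro: PiE_ext)
  qed
  moreover have "?\<Phi> ` ?B \<subseteq> {S. finite S \<and> S \<subseteq> carrier H \<times> carrier G}"
    by (auto simp: B PiE_iff)
  then have "countable (?\<Phi> ` ?B)"
    using cG cH by (rule_tac countable_subset[OF _ countable_Collect_finite_subset]) auto
  ultimately have "countable ?B" by (rule countable_image_inj_on[rotated])
  then show ?thesis
    using cH by (simp add: wreath_product_def semidirect_product_def)
qed

lemma sofic_approximation_transfer:
  assumes b: "bij_betw b A B" and G: "group G" and F: "F \<subseteq> carrier G"
    and s: "sofic_approximation G F \<epsilon> A \<sigma>"
  shows "\<exists>\<tau>. sofic_approximation G F \<epsilon> B \<tau>"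
proof -
  interpret group G by (fact G)
  let ?c = "the_inv_into A b"
  define \<tau> where "\<tau> g = (\<lambda>y\<in>B. b (\<sigma> g (?c y)))" for g
  have c: "bij_betw ?c B A" using b by (rule bij_betw_the_inv_into)
  have bc: "b (?c y) = y" if "y \<in> B" for y
    using b that by (simp add: f_the_inv_into_f_bij_betw)
  have cb: "?c (b x) = x" if "x \<in> A" for x
    using b that by (simp add: bij_betw_def the_inv_into_f_f)
  have cB: "?c y \<in> A" if "y \<in> B" for y using c that by (auto simp: bij_betw_def)
  have bA: "b x \<in> B" if "x \<in> A" for x using b that by (auto simp: bij_betw_def)
  have \<sigma>: "\<sigma> g \<in> Bij A" if "g \<in> carrier G" for g
    using s that by (auto simp: sofic_approximation_def BijGroup_def)
  have \<sigma>A: "\<sigma> g x \<in> A" if "g \<in> carrier G" "x \<in> A" for g x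
    using Bij_imp_funcset[OF \<sigma>] that by blast
  have \<tau>: "\<tau> g \<in> Bij B" if g: "g \<in> carrier G" for g
  proof -
    have "bij_betw (\<sigma> g) A A" using \<sigma>[OF g] by (simp add: Bij_def)
    then have "bij_betw (b \<circ> (\<sigma> g \<circ> ?c)) B B"
      using b c by (blast intro: bij_betw_trans)
    then show ?thesis by (simp add: \<tau>_def Bij_def comp_def cong: bij_betw_cong)
  qed
  have card: "card B = card A" using bij_betw_same_card[OF b] by simp
  have dist: "hamming_dist B \<pi>' \<rho>' = hamming_dist A \<pi> \<rho>"
    if "\<And>x. x \<in> A \<Longrightarrow> \<pi> x \<in> A" "\<And>x. x \<in> A \<Longrightarrow> \<rho> x \<in> A"
      "\<And>x. x \<in> A \<Longrightarrow> \<pi>' (b x) = b (\<pi> x)" "\<And>x. x \<in> A \<Longrightarrow> \<rho>' (b x) = b (\<rho> x)" for \<pi> \<rho> \<pi>' \<rho>'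
  proof -
    have inj: "inj_on b A" and im: "b ` A = B" using b by (auto simp: bij_betw_def)
    have "{y \<in> B. \<pi>' y \<noteq> \<rho>' y} = b ` {x \<in> A. \<pi> x \<noteq> \<rho> x}"
      using that inj by (auto simp: im[symmetric] inj_on_eq_iff)
    moreover have "inj_on b {x \<in> A. \<pi> x \<noteq> \<rho> x}" using inj by (rule inj_on_subset) auto
    ultimately show ?thesis by (simp add: hamming_dist_def card card_image)
  qed
  have one: "\<tau> \<one>\<^bsub>G\<^esub> = (\<lambda>y\<in>B. y)"
    using s by (auto simp: \<tau>_def sofic_approximation_def BijGroup_def bc cB intro!: restrict_ext)
  have mult: "hamming_dist B (\<tau> (g \<otimes>\<^bsub>G\<^esub> h)) (\<tau> g \<otimes>\<^bsub>BijGroup B\<^esub> \<tau> h) =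
      hamming_dist A (\<sigma> (g \<otimes>\<^bsub>G\<^esub> h)) (\<sigma> g \<otimes>\<^bsub>BijGroup A\<^esub> \<sigma> h)"
    if "g \<in> carrier G" "h \<in> carrier G" for g h
  proof (rule dist)
    fix x assume x: "x \<in> A"
    show "(\<tau> g \<otimes>\<^bsub>BijGroup B\<^esub> \<tau> h) (b x) = b ((\<sigma> g \<otimes>\<^bsub>BijGroup A\<^esub> \<sigma> h) x)"
      using that \<sigma>[OF that(1)] \<sigma>[OF that(2)] \<tau>[OF that(1)] \<tau>[OF that(2)] x
      by (simp add: BijGroup_def compose_def) (simp add: \<tau>_def \<sigma>A bA cb)
  qed (use that in \<open>auto simp: BijGroup_def \<sigma> compose_def \<sigma>A \<tau>_def bA cb\<close>)
  have len: "hamming_length B (\<tau> g) = hamming_length A (\<sigma> g)" if "g \<in> carrier G" for g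
    unfolding hamming_length_def
    using that by (intro dist) (auto simp: BijGroup_def \<sigma>A \<tau>_def bA cb)
  have "finite B" "B \<noteq> {}"
    using b s bij_betw_finite[OF b] by (auto simp: sofic_approximation_def bij_betw_def)
  then have "sofic_approximation G F \<epsilon> B \<tau>"
    using s F one \<tau> mult len by (auto simp: sofic_approximation_def BijGroup_def subset_iff)
  then show ?thesis by blast
qed

lemma sofic_approximation_nat:
  assumes "group G" and "F \<subseteq> carrier G" and "sofic_approximation G F \<epsilon> A \<sigma>"
  shows "\<exists>(B :: nat set) \<tau>. sofic_approximation G F \<epsilon> B \<tau>"
proof -
  have "finite A" using assms(3) by (simp add: sofic_approximation_def)
  then obtain b where "bij_betw b A {0..<card A}"
    using ex_bij_betw_finite_nat by blast
  from sofic_approximation_transfer[OF this assms] show ?thesis by blast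
qed

end

theory Submission
  imports Defs
begin

text \<open>
  Suppose first that \<open>G\<close> acts on a set \<open>A\<close> and \<open>H\<close> acts on a set \<open>B\<close> simply transitively. Then
  \<open>G \<wr> H\<close> acts on \<open>A\<^sup>B \<times> B\<close>: think of a pair \<open>(\<phi>, b)\<close> as lamps with states \<open>\<phi> c\<close> at the places
  \<open>c \<in> B\<close>, together with a walker at \<open>b\<close>. An element \<open>h\<close> of \<open>H\<close> moves the walker to \<open>h b\<close>, while an
  element \<open>g\<close> of the base group changes the state of the lamp at \<open>c\<close> by \<open>g\<^sub>x\<close>, where \<open>x\<close> is the element
  with \<open>x c = b\<close>, that is, the position of the walker relative to the lamp. Conjugation by \<open>h\<close> moves
  the walker, and so shifts the coordinates of \<open>g\<close>.

  The same formula works for sofic approximations \<open>\<theta>\<close> of \<open>G\<close> on \<open>A\<close> and \<open>\<sigma>\<close> of \<open>H\<close> on \<open>B\<close>, once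
  \<open>x\<close> is restricted to a finite set \<open>E\<close> that contains the finitely many relevant supports, and \<open>g\<^sub>x\<close>
  is read as \<open>1\<close> when \<open>x\<close> does not exist or is not unique. Call a place regular if \<open>\<sigma>\<close> is
  multiplicative and free there, as far as a finite set \<open>L\<close> is concerned; most places are regular.
  Call a walker position clear if all the lamps that it can reach through \<open>E\<close> stand at regular
  places. As each \<open>\<sigma> x\<close> is a bijection, at most \<open>card E\<close> times as many positions fail to be clear as
  places fail to be regular, and so most positions are clear. When the walker moves from one clear
  position to another, the shift rule holds exactly (\<open>lamp_shift\<close>), so the only remaining
  defects come from \<open>\<theta>\<close>. From a given position at most \<open>card E\<close> lamps can be reached, and for each of them the defect of
  \<open>\<theta>\<close> excludes only a small proportion of the states. The number of reachable lamps does
  not depend on \<open>B\<close>, and this is why the total error stays small (\<open>lamp_action_almost_mult\<close>).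

  Finally, an element with \<open>h \<noteq> 1\<close> moves the walker at every regular position, and an
  element \<open>(g, 1)\<close> with \<open>g\<^sub>x \<noteq> 1\<close> changes, from a clear position, the lamp that is reached
  through \<open>x\<close>, for most of its states (\<open>lamp_action_almost_free\<close>).
\<close>

section \<open>Counting configurations\<close>

lemma card_PiE_coordinate:
  assumes B: "finite B" and c: "c \<in> B" and T: "T \<subseteq> A"
  shows "card {\<phi> \<in> B \<rightarrow>\<^sub>E A. \<phi> c \<in> T} * card A = card T * card (B \<rightarrow>\<^sub>E A)"
proof -
  have "{\<phi> \<in> B \<rightarrow>\<^sub>E A. \<phi> c \<in> T} = PiE B (\<lambda>i. if i = c then T else A)"
    using c T by (auto simp: PiE_iff extensional_def split: if_splits) (metis subsetD)
  then have "card {\<phi> \<in> B \<rightarrow>\<^sub>E A. \<phi> c \<in> T} = (\<Prod>i\<in>B. card (if i = c then T else A))"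
    using B by (simp add: card_PiE)
  also have "\<dots> = card T * (\<Prod>i\<in>B - {c}. card A)"
    using B c by (simp add: prod.remove[OF B c])
  finally show ?thesis
    using B c by (simp add: card_PiE prod.remove[OF B c, of "\<lambda>_. card A"] del: prod_constant)
qed

text \<open>The bound does not depend on \<^term>\<open>B\<close>: only the coordinates in \<^term>\<open>C\<close> count.\<close>

lemma card_PiE_some_coordinate:
  assumes A: "finite A" "A \<noteq> {}" and B: "finite B" and C: "C \<subseteq> B"
    and T: "\<And>c. c \<in> C \<Longrightarrow> T c \<subseteq> A"
    and small: "\<And>c. c \<in> C \<Longrightarrow> real (card (T c)) \<le> \<delta> * real (card A)"
  shows "real (card {\<phi> \<in> B \<rightarrow>\<^sub>E A. \<exists>c\<in>C. \<phi> c \<in> T c}) \<le> real (card C) * \<delta> * real (card (B \<rightarrow>\<^sub>E A))"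
proof -
  have fC: "finite C" using B C by (rule finite_subset[rotated])
  have A0: "real (card A) > 0" using A by (simp add: card_gt_0_iff)
  have one: "real (card {\<phi> \<in> B \<rightarrow>\<^sub>E A. \<phi> c \<in> T c}) \<le> \<delta> * real (card (B \<rightarrow>\<^sub>E A))" if c: "c \<in> C" for c
  proof -
    have "real (card {\<phi> \<in> B \<rightarrow>\<^sub>E A. \<phi> c \<in> T c}) * real (card A)
        = real (card (T c)) * real (card (B \<rightarrow>\<^sub>E A))"
      using card_PiE_coordinate[OF B _ T[OF c], of c] c C by (auto simp flip: of_nat_mult)
    also have "\<dots> \<le> (\<delta> * real (card A)) * real (card (B \<rightarrow>\<^sub>E A))"
      using small[OF c] by (rule mult_right_mono) simp
    finally show ?thesis using A0 by (simp add: mult.assoc mult.commute[of "real (card A)"] mult.left_commute)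
  qed
  have "{\<phi> \<in> B \<rightarrow>\<^sub>E A. \<exists>c\<in>C. \<phi> c \<in> T c} = (\<Union>c\<in>C. {\<phi> \<in> B \<rightarrow>\<^sub>E A. \<phi> c \<in> T c})" by auto
  then have "card {\<phi> \<in> B \<rightarrow>\<^sub>E A. \<exists>c\<in>C. \<phi> c \<in> T c} \<le> (\<Sum>c\<in>C. card {\<phi> \<in> B \<rightarrow>\<^sub>E A. \<phi> c \<in> T c})"
    by (simp only: card_UN_le[OF fC])
  then have "real (card {\<phi> \<in> B \<rightarrow>\<^sub>E A. \<exists>c\<in>C. \<phi> c \<in> T c})
      \<le> (\<Sum>c\<in>C. real (card {\<phi> \<in> B \<rightarrow>\<^sub>E A. \<phi> c \<in> T c}))"
    by (simp flip: of_nat_sum)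
  also have "\<dots> \<le> (\<Sum>c\<in>C. \<delta> * real (card (B \<rightarrow>\<^sub>E A)))" by (rule sum_mono) (rule one)
  finally show ?thesis by simp
qed

text \<open>This combines the two kinds of error: those of \<open>\<sigma>\<close> exclude whole fibres, those of \<open>\<theta>\<close> a small
  part of each remaining fibre.\<close>

lemma card_fibrewise_le:
  assumes U: "finite U" and B: "finite B" and S: "S \<subseteq> U \<times> B" and D: "D \<subseteq> B"
    and D_small: "real (card D) \<le> \<beta> * real (card B)" and \<delta>: "0 \<le> \<delta>"
    and fibre: "\<And>b. b \<in> B - D \<Longrightarrow> real (card {\<phi> \<in> U. (\<phi>, b) \<in> S}) \<le> \<delta> * real (card U)"
  shows "real (card S) \<le> (\<beta> + \<delta>) * real (card (U \<times> B))"
proof -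
  have fB: "finite (B - D)" and fD: "finite D" using B D by (auto intro: finite_subset)
  have "S \<subseteq> U \<times> D \<union> (\<Union>b\<in>B - D. (\<lambda>\<phi>. (\<phi>, b)) ` {\<phi> \<in> U. (\<phi>, b) \<in> S})"
    using S by auto
  then have "card S \<le> card (U \<times> D \<union> (\<Union>b\<in>B - D. (\<lambda>\<phi>. (\<phi>, b)) ` {\<phi> \<in> U. (\<phi>, b) \<in> S}))"
    using U fB fD by (intro card_mono) auto
  also have "\<dots> \<le> card (U \<times> D) + card (\<Union>b\<in>B - D. (\<lambda>\<phi>. (\<phi>, b)) ` {\<phi> \<in> U. (\<phi>, b) \<in> S})"
    by (rule card_Un_le)
  also have "\<dots> \<le> card (U \<times> D) + (\<Sum>b\<in>B - D. card ((\<lambda>\<phi>. (\<phi>, b)) ` {\<phi> \<in> U. (\<phi>, b) \<in> S}))"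
    using card_UN_le[OF fB] by (intro add_left_mono)
  also have "\<dots> \<le> card U * card D + (\<Sum>b\<in>B - D. card {\<phi> \<in> U. (\<phi>, b) \<in> S})"
    unfolding card_cartesian_product using U by (intro add_left_mono sum_mono card_image_le) auto
  finally have "real (card S) \<le> real (card U * card D + (\<Sum>b\<in>B - D. card {\<phi> \<in> U. (\<phi>, b) \<in> S}))"
    by (rule of_nat_mono)
  also have "\<dots> = real (card U) * real (card D) + (\<Sum>b\<in>B - D. real (card {\<phi> \<in> U. (\<phi>, b) \<in> S}))"
    by simp
  also have "\<dots> \<le> real (card U) * (\<beta> * real (card B)) + (\<Sum>b\<in>B - D. \<delta> * real (card U))"
    using D_small by (intro add_mono mult_left_mono sum_mono fibre) auto
  also have "\<dots> \<le> real (card U) * (\<beta> * real (card B)) + real (card B) * (\<delta> * real (card U))"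
    using \<delta> B by (auto intro!: mult_right_mono card_mono)
  also have "\<dots> = (\<beta> + \<delta>) * real (card (U \<times> B))"
    by (simp add: card_cartesian_product algebra_simps)
  finally show ?thesis .
qed

lemma card_inj_preimage_le:
  assumes "finite B" and "inj_on f B" and "S \<subseteq> B"
  shows "card {b \<in> B. f b \<in> S} \<le> card S"
  using assms by (intro card_inj_on_le[of f]) (auto intro: inj_on_subset finite_subset)

section \<open>Elements of wreath products\<close>

lemma wreath_base_carrier:
  assumes "group G"
  shows "carrier (wreath_base G H)
    = {g \<in> carrier H \<rightarrow>\<^sub>E carrier G. finite {x \<in> carrier H. g x \<noteq> \<one>\<^bsub>G\<^esub>}}"
  using assms by (simp add: carrier_sum_group)

lemma wreath_carrier: "carrier (wreath_product G H) = carrier (wreath_base G H) \<times> carrier H"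
  by (simp add: wreath_product_def semidirect_product_def)

lemma wreath_mult:
  "(g, h) \<otimes>\<^bsub>wreath_product G H\<^esub> (g', h')
    = (g \<otimes>\<^bsub>wreath_base G H\<^esub> wreath_shift G H h g', h \<otimes>\<^bsub>H\<^esub> h')"
  by (simp add: wreath_product_def semidirect_product_def del: mult_sum_group)

lemma wreath_one: "\<one>\<^bsub>wreath_product G H\<^esub> = (\<one>\<^bsub>wreath_base G H\<^esub>, \<one>\<^bsub>H\<^esub>)"
  by (simp add: wreath_product_def semidirect_product_def)

lemma wreath_shift_apply:
  assumes "g \<in> carrier (wreath_base G H)" and "x \<in> carrier H"
  shows "wreath_shift G H h g x = g (inv\<^bsub>H\<^esub> h \<otimes>\<^bsub>H\<^esub> x)"
  using assms by (simp add: wreath_shift_def)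

lemma wreath_shift_closed:
  assumes "group G" and "group H" and "h \<in> carrier H" and "g \<in> carrier (wreath_base G H)"
  shows "wreath_shift G H h g \<in> carrier (wreath_base G H)"
proof -
  have "wreath_shift G H h \<in> auto (wreath_base G H)"
    using wreath_shift_hom[OF assms(1,2)] assms(3) by (auto simp: hom_def AutoGroup_def)
  then show ?thesis using assms(4) by (auto simp: auto_def hom_def)
qed

section \<open>Sofic approximations\<close>

lemma hamming_dist_less_iff:
  assumes "finite A" and "A \<noteq> {}"
  shows "hamming_dist A p q < \<epsilon> \<longleftrightarrow> real (card {a \<in> A. p a \<noteq> q a}) < \<epsilon> * real (card A)"
  using assms by (simp add: hamming_dist_def divide_less_eq card_gt_0_iff)

lemma hamming_length_greater_iff:
  assumes "finite A" and "A \<noteq> {}"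
  shows "hamming_length A p > 1 - \<epsilon> \<longleftrightarrow> real (card {a \<in> A. p a = a}) < \<epsilon> * real (card A)"
proof -
  have "{a \<in> A. p a \<noteq> \<one>\<^bsub>BijGroup A\<^esub> a} = A - {a \<in> A. p a = a}" by (auto simp: BijGroup_def)
  then have "real (card {a \<in> A. p a \<noteq> \<one>\<^bsub>BijGroup A\<^esub> a}) = real (card A) - real (card {a \<in> A. p a = a})"
    using assms by (simp add: card_Diff_subset of_nat_diff card_mono)
  then show ?thesis
    using assms by (auto simp: hamming_length_def hamming_dist_def field_simps card_gt_0_iff)
qed

lemma BijGroup_mult_apply:
  "p \<in> carrier (BijGroup A) \<Longrightarrow> q \<in> carrier (BijGroup A) \<Longrightarrow> a \<in> A
    \<Longrightarrow> (p \<otimes>\<^bsub>BijGroup A\<^esub> q) a = p (q a)"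
  by (simp add: BijGroup_def compose_def)

lemma BijGroup_bij_betw: "p \<in> carrier (BijGroup A) \<Longrightarrow> bij_betw p A A"
  by (simp add: BijGroup_def Bij_def)

lemma sofic_approximationD:
  assumes "sofic_approximation G F \<epsilon> A \<sigma>"
  shows "finite A" and "A \<noteq> {}"
    and "\<And>g. g \<in> carrier G \<Longrightarrow> \<sigma> g \<in> carrier (BijGroup A)"
    and "\<And>g. g \<in> carrier G \<Longrightarrow> bij_betw (\<sigma> g) A A"
    and "\<And>a. a \<in> A \<Longrightarrow> \<sigma> \<one>\<^bsub>G\<^esub> a = a"
  using assms by (auto simp: sofic_approximation_def BijGroup_def Bij_def)

lemma sofic_approximation_almost_mult:
  assumes s: "sofic_approximation G F \<epsilon> A \<sigma>" and F: "F \<subseteq> carrier G" and "g \<in> F" "h \<in> F"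
  shows "real (card {a \<in> A. \<sigma> (g \<otimes>\<^bsub>G\<^esub> h) a \<noteq> \<sigma> g (\<sigma> h a)}) < \<epsilon> * real (card A)"
proof -
  have "{a \<in> A. \<sigma> (g \<otimes>\<^bsub>G\<^esub> h) a \<noteq> (\<sigma> g \<otimes>\<^bsub>BijGroup A\<^esub> \<sigma> h) a} = {a \<in> A. \<sigma> (g \<otimes>\<^bsub>G\<^esub> h) a \<noteq> \<sigma> g (\<sigma> h a)}"
    using assms sofic_approximationD(3)[OF s] by (auto simp: BijGroup_mult_apply subset_iff)
  moreover have "hamming_dist A (\<sigma> (g \<otimes>\<^bsub>G\<^esub> h)) (\<sigma> g \<otimes>\<^bsub>BijGroup A\<^esub> \<sigma> h) < \<epsilon>"
    using assms by (simp add: sofic_approximation_def)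
  ultimately show ?thesis
    by (simp add: hamming_dist_less_iff[OF sofic_approximationD(1,2)[OF s]])
qed

lemma sofic_approximation_almost_free:
  assumes s: "sofic_approximation G F \<epsilon> A \<sigma>" and "g \<in> F" "g \<noteq> \<one>\<^bsub>G\<^esub>"
  shows "real (card {a \<in> A. \<sigma> g a = a}) < \<epsilon> * real (card A)"
proof -
  have "hamming_length A (\<sigma> g) > 1 - \<epsilon>" using assms by (simp add: sofic_approximation_def)
  then show ?thesis by (simp add: hamming_length_greater_iff[OF sofic_approximationD(1,2)[OF s]])
qed

section \<open>Lamps and walkers\<close>

text \<open>The inclusion of the quotients \<open>x\<^sup>-\<^sup>1 y\<close> in \<^term>\<open>L\<close> makes \<^term>\<open>\<sigma> x c\<close> and \<^term>\<open>\<sigma> y c\<close>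
  different for most \<^term>\<open>c\<close> when \<^term>\<open>x\<close> and \<^term>\<open>y\<close> are different elements of \<^term>\<open>E\<close>.\<close>

locale lamplighter = G: group G + H: group H
  for G :: "('g, 'p) monoid_scheme" (structure) and H :: "('h, 'q) monoid_scheme" (structure) +
  fixes P :: "'g set" and \<delta> :: real and A :: "'a set" and \<theta> :: "'g \<Rightarrow> 'a \<Rightarrow> 'a"
    and L :: "'h set" and \<eta> :: real and B :: "'b set" and \<sigma> :: "'h \<Rightarrow> 'b \<Rightarrow> 'b"
    and E :: "'h set"
  assumes approx_G: "sofic_approximation G P \<delta> A \<theta>" and P: "P \<subseteq> carrier G"
    and approx_H: "sofic_approximation H L \<eta> B \<sigma>" and L: "L \<subseteq> carrier H" "finite L"
    and E: "E \<subseteq> L"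
    and quotients: "\<And>x y. x \<in> E \<Longrightarrow> y \<in> E \<Longrightarrow> inv\<^bsub>H\<^esub> x \<otimes>\<^bsub>H\<^esub> y \<in> L"
    and \<delta>: "\<delta> > 0" and \<eta>: "\<eta> > 0"
begin

text \<open>This is the coordinate of \<^term>\<open>g\<close> that acts on the lamp at \<^term>\<open>c\<close> when the walker stands
  at \<^term>\<open>b\<close>. The default value \<^term>\<open>\<one>\<^bsub>G\<^esub>\<close> leaves the lamp alone. The choice of \<^term>\<open>x\<close> ranges
  over the fixed set \<^term>\<open>E\<close> and not over the support of \<^term>\<open>g\<close>, so it is the same for
  all \<^term>\<open>g\<close>; therefore \<open>lamp_mult\<close> holds without exceptions.\<close>

definition lamp :: "('h \<Rightarrow> 'g) \<Rightarrow> 'b \<Rightarrow> 'b \<Rightarrow> 'g"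
  where "lamp g c b = (if \<exists>!x. x \<in> E \<and> \<sigma> x c = b then g (THE x. x \<in> E \<and> \<sigma> x c = b) else \<one>\<^bsub>G\<^esub>)"

definition configurations :: "(('b \<Rightarrow> 'a) \<times> 'b) set"
  where "configurations = (B \<rightarrow>\<^sub>E A) \<times> B"

text \<open>In the wreath product \<open>(g, h)\<close> is the product of \<open>g\<close> and \<open>h\<close> in this order, so the walker moves
  first, and the lamps are read from its new position.\<close>

definition lamp_action :: "('h \<Rightarrow> 'g) \<times> 'h \<Rightarrow> ('b \<Rightarrow> 'a) \<times> 'b \<Rightarrow> ('b \<Rightarrow> 'a) \<times> 'b"
  where "lamp_action = (\<lambda>(g, h). \<lambda>(\<phi>, b) \<in> configurations.
    ((\<lambda>c\<in>B. \<theta> (lamp g c (\<sigma> h b)) (\<phi> c)), \<sigma> h b))"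

definition regular :: "'b \<Rightarrow> bool"
  where "regular c \<longleftrightarrow> (\<forall>x\<in>L. \<forall>y\<in>L. \<sigma> (x \<otimes>\<^bsub>H\<^esub> y) c = \<sigma> x (\<sigma> y c)) \<and> (\<forall>z\<in>L - {\<one>\<^bsub>H\<^esub>}. \<sigma> z c \<noteq> c)"

definition clear :: "'b \<Rightarrow> bool"
  where "clear b \<longleftrightarrow> (\<forall>x\<in>E. \<forall>c\<in>B. \<sigma> x c = b \<longrightarrow> regular c)"

text \<open>Finite support makes it possible to achieve this for any finite set of elements by
  enlarging \<^term>\<open>P\<close>, \<^term>\<open>L\<close> and \<^term>\<open>E\<close>.\<close>

definition controlled :: "('h \<Rightarrow> 'g) \<times> 'h \<Rightarrow> bool"
  where "controlled = (\<lambda>(g, h). g \<in> carrier (wreath_base G H) \<and> h \<in> L \<and>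
    (\<forall>x\<in>carrier H. g x \<noteq> \<one>\<^bsub>G\<^esub> \<longrightarrow> x \<in> E \<and> g x \<in> P))"

lemmas \<theta>D = sofic_approximationD[OF approx_G]
lemmas \<sigma>D = sofic_approximationD[OF approx_H]

lemma E_finite: "finite E" and E_carrier: "x \<in> E \<Longrightarrow> x \<in> carrier H"
  using E L by (auto intro: finite_subset)

lemma \<sigma>_in: "h \<in> carrier H \<Longrightarrow> b \<in> B \<Longrightarrow> \<sigma> h b \<in> B"
  using \<sigma>D(4) by (auto simp: bij_betw_def)

lemma \<sigma>_inj: "h \<in> carrier H \<Longrightarrow> b \<in> B \<Longrightarrow> c \<in> B \<Longrightarrow> \<sigma> h b = \<sigma> h c \<longleftrightarrow> b = c"
  by (metis \<sigma>D(4) bij_betw_def inj_on_eq_iff)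

lemma \<theta>_in: "g \<in> carrier G \<Longrightarrow> a \<in> A \<Longrightarrow> \<theta> g a \<in> A"
  using \<theta>D(4) by (auto simp: bij_betw_def)

lemma base_in: "g \<in> carrier (wreath_base G H) \<Longrightarrow> x \<in> carrier H \<Longrightarrow> g x \<in> carrier G"
  by (auto simp: wreath_base_carrier[OF G.is_group])

lemma lamp_cases:
  obtains (unlit) "\<And>g. lamp g c b = \<one>\<^bsub>G\<^esub>"
    | (lit) x where "x \<in> E" "\<sigma> x c = b" "\<And>g. lamp g c b = g x"
proof (cases "\<exists>!x. x \<in> E \<and> \<sigma> x c = b")
  case True
  then obtain x where x: "x \<in> E" "\<sigma> x c = b" by blast
  then have "(THE x. x \<in> E \<and> \<sigma> x c = b) = x" using True by (blast intro: the_equality)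
  then show ?thesis using True x lit by (simp add: lamp_def)
next
  case False
  then have "\<And>g. lamp g c b = \<one>\<^bsub>G\<^esub>" unfolding lamp_def by simp
  then show ?thesis by (rule unlit)
qed

lemma lamp_closed: "g \<in> carrier (wreath_base G H) \<Longrightarrow> lamp g c b \<in> carrier G"
  by (rule lamp_cases[of c b]) (auto simp: base_in E_carrier)

lemma lamp_one: "lamp \<one>\<^bsub>wreath_base G H\<^esub> c b = \<one>\<^bsub>G\<^esub>"
  by (rule lamp_cases[of c b]) (auto simp: E_carrier)

lemma lamp_mult:
  "lamp (g \<otimes>\<^bsub>wreath_base G H\<^esub> g') c b = lamp g c b \<otimes>\<^bsub>G\<^esub> lamp g' c b"
  by (rule lamp_cases[of c b]) (auto simp: E_carrier)

text \<open>If \<^term>\<open>x\<close> and \<^term>\<open>y\<close> differ, then \<open>z = x\<^sup>-\<^sup>1 y\<close> moves \<^term>\<open>c\<close>, and \<^term>\<open>\<sigma> x\<close> keeps \<^term>\<open>c\<close> and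
  \<^term>\<open>\<sigma> z c\<close> apart; but it sends the second point to \<^term>\<open>\<sigma> y c\<close>.\<close>

lemma regular_free:
  assumes c: "c \<in> B" "regular c" and x: "x \<in> E" and y: "y \<in> E" and eq: "\<sigma> x c = \<sigma> y c"
  shows "x = y"
proof (rule ccontr)
  assume "x \<noteq> y"
  let ?z = "inv\<^bsub>H\<^esub> x \<otimes>\<^bsub>H\<^esub> y"
  have xz: "x \<otimes>\<^bsub>H\<^esub> ?z = y" using x y by (simp add: E_carrier flip: H.m_assoc)
  have z: "?z \<in> L" using x y by (rule quotients)
  have "?z \<noteq> \<one>\<^bsub>H\<^esub>" using xz x \<open>x \<noteq> y\<close> E_carrier by (metis H.r_one)
  then have "\<sigma> ?z c \<noteq> c" using c z by (simp add: regular_def)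
  moreover have "\<sigma> y c = \<sigma> x (\<sigma> ?z c)"
    using c x z E xz unfolding regular_def by (metis subsetD)
  ultimately show False
    using \<sigma>_inj[of x "\<sigma> ?z c" c] eq c x z L \<sigma>_in E_carrier by (metis subsetD)
qed

lemma lamp_clear:
  assumes "clear b" and "c \<in> B" and "x \<in> E" and "\<sigma> x c = b"
  shows "lamp g c b = g x"
proof -
  have "regular c" using assms by (auto simp: clear_def)
  then have "y = x" if "y \<in> E" "\<sigma> y c = b" for y
    using regular_free assms that by metis
  then have "(THE x. x \<in> E \<and> \<sigma> x c = b) = x" "\<exists>!x. x \<in> E \<and> \<sigma> x c = b"
    using assms by (blast intro: the_equality)+
  then show ?thesis by (simp add: lamp_def)
qed

text \<open>The lamp at \<^term>\<open>c\<close> sees the walker at relative position \<^term>\<open>x\<close> before the move and at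
  \<open>h x\<close> after it, and the shift undoes exactly this change. Clearness of the old position gives
  \<open>\<sigma> (h x) c = \<sigma> h b\<close> from \<open>\<sigma> x c = b\<close>, and clearness of the new one gives the converse.\<close>

lemma lamp_shift:
  assumes h: "h \<in> L" and g: "g \<in> carrier (wreath_base G H)"
    and supp: "\<And>x. x \<in> carrier H \<Longrightarrow> g x \<noteq> \<one>\<^bsub>G\<^esub> \<Longrightarrow> x \<in> E \<and> h \<otimes>\<^bsub>H\<^esub> x \<in> E"
    and b: "b \<in> B" and c: "c \<in> B" and clear: "clear b" "clear (\<sigma> h b)"
  shows "lamp (wreath_shift G H h g) c (\<sigma> h b) = lamp g c b"
proof -
  have hH: "h \<in> carrier H" using h L by blast
  show ?thesis
  proof (cases "\<exists>x\<in>E. \<sigma> x c = b \<and> g x \<noteq> \<one>\<^bsub>G\<^esub>")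
    case True
    then obtain x where x: "x \<in> E" "\<sigma> x c = b" "g x \<noteq> \<one>\<^bsub>G\<^esub>" by blast
    have xH: "x \<in> carrier H" using x E_carrier by blast
    have hx: "h \<otimes>\<^bsub>H\<^esub> x \<in> E" using supp[OF xH] x by blast
    have "regular c" using clear(1) x c by (auto simp: clear_def)
    then have "\<sigma> (h \<otimes>\<^bsub>H\<^esub> x) c = \<sigma> h b" using h x E by (auto simp: regular_def)
    then have "lamp (wreath_shift G H h g) c (\<sigma> h b) = wreath_shift G H h g (h \<otimes>\<^bsub>H\<^esub> x)"
      using clear(2) c hx by (intro lamp_clear)
    also have "\<dots> = g x"
      using g hH xH by (simp add: wreath_shift_apply flip: H.m_assoc)
    also have "\<dots> = lamp g c b" using lamp_clear[OF clear(1) c] x by simp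
    finally show ?thesis .
  next
    case False
    have "lamp g c b = \<one>\<^bsub>G\<^esub>" using False by (cases rule: lamp_cases[of c b]) auto
    moreover have "lamp (wreath_shift G H h g) c (\<sigma> h b) = \<one>\<^bsub>G\<^esub>"
    proof (cases rule: lamp_cases[of c "\<sigma> h b"])
      case (lit y)
      have yH: "y \<in> carrier H" using lit E_carrier by blast
      let ?x = "inv\<^bsub>H\<^esub> h \<otimes>\<^bsub>H\<^esub> y"
      have xH: "?x \<in> carrier H" using yH hH by simp
      have hx: "h \<otimes>\<^bsub>H\<^esub> ?x = y" using yH hH by (simp flip: H.m_assoc)
      have "g ?x = \<one>\<^bsub>G\<^esub>"
      proof (rule ccontr)
        assume gx: "g ?x \<noteq> \<one>\<^bsub>G\<^esub>"
        then have xE: "?x \<in> E" using supp[OF xH] by blast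
        have "regular c" using clear(2) lit c by (auto simp: clear_def)
        then have "\<sigma> (h \<otimes>\<^bsub>H\<^esub> ?x) c = \<sigma> h (\<sigma> ?x c)" using h xE E by (auto simp: regular_def)
        then have "\<sigma> h (\<sigma> ?x c) = \<sigma> h b" using hx lit by simp
        then have "\<sigma> ?x c = b" using \<sigma>_inj[OF hH] \<sigma>_in[OF xH c] b by blast
        then show False using False xE gx by blast
      qed
      then show ?thesis using lit g yH by (simp add: wreath_shift_apply)
    qed simp
    ultimately show ?thesis by simp
  qed
qed

section \<open>The lamp action consists of permutations\<close>

lemma configurations_finite: "finite configurations" and configurations_nonempty: "configurations \<noteq> {}"
  using \<theta>D(1,2) \<sigma>D(1,2) by (auto simp: configurations_def finite_PiE PiE_eq_empty_iff)

lemma lamp_action_apply: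
  "\<phi> \<in> B \<rightarrow>\<^sub>E A \<Longrightarrow> b \<in> B
    \<Longrightarrow> lamp_action (g, h) (\<phi>, b) = ((\<lambda>c\<in>B. \<theta> (lamp g c (\<sigma> h b)) (\<phi> c)), \<sigma> h b)"
  by (simp add: lamp_action_def configurations_def)

lemma lamp_action_closed:
  assumes "g \<in> carrier (wreath_base G H)" and "h \<in> carrier H" and "w \<in> configurations"
  shows "lamp_action (g, h) w \<in> configurations"
  using assms by (auto simp: lamp_action_def configurations_def \<sigma>_in intro!: \<theta>_in lamp_closed)

lemma lamp_action_bij:
  assumes g: "g \<in> carrier (wreath_base G H)" and h: "h \<in> carrier H"
  shows "lamp_action (g, h) \<in> carrier (BijGroup configurations)"
proof -
  have "inj_on (lamp_action (g, h)) configurations"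
  proof (rule inj_onI)
    fix v w assume v: "v \<in> configurations" and w: "w \<in> configurations"
      and eq: "lamp_action (g, h) v = lamp_action (g, h) w"
    obtain \<phi> b where v': "v = (\<phi>, b)" "\<phi> \<in> B \<rightarrow>\<^sub>E A" "b \<in> B" using v by (auto simp: configurations_def)
    obtain \<psi> d where w': "w = (\<psi>, d)" "\<psi> \<in> B \<rightarrow>\<^sub>E A" "d \<in> B" using w by (auto simp: configurations_def)
    have bd: "b = d" using eq v' w' \<sigma>_inj[OF h] by (simp add: lamp_action_apply)
    have "\<phi> c = \<psi> c" if c: "c \<in> B" for c
    proof -
      have "(\<lambda>c\<in>B. \<theta> (lamp g c (\<sigma> h b)) (\<phi> c)) = (\<lambda>c\<in>B. \<theta> (lamp g c (\<sigma> h b)) (\<psi> c))"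
        using eq v' w' bd by (simp add: lamp_action_apply)
      from fun_cong[OF this, of c] c
      have "\<theta> (lamp g c (\<sigma> h b)) (\<phi> c) = \<theta> (lamp g c (\<sigma> h b)) (\<psi> c)"
        by simp
      moreover have "\<phi> c \<in> A" "\<psi> c \<in> A"
        using PiE_mem[OF v'(2) c] PiE_mem[OF w'(2) c] .
      ultimately show ?thesis
        by (rule inj_onD[OF bij_betw_imp_inj_on[OF \<theta>D(4)[OF lamp_closed[OF g]]]])
    qed
    then have "\<phi> = \<psi>" by (rule PiE_ext[OF v'(2) w'(2)])
    then show "v = w" using v'(1) w'(1) bd by simp
  qed
  moreover have "lamp_action (g, h) ` configurations \<subseteq> configurations"
    using lamp_action_closed[OF g h] by blast
  ultimately have "bij_betw (lamp_action (g, h)) configurations configurations"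
    using endo_inj_surj[OF configurations_finite] by (simp add: bij_betw_def)
  then show ?thesis by (simp add: BijGroup_def Bij_def lamp_action_def)
qed

lemma lamp_action_one: "lamp_action (\<one>\<^bsub>wreath_base G H\<^esub>, \<one>\<^bsub>H\<^esub>) = \<one>\<^bsub>BijGroup configurations\<^esub>"
proof
  fix w
  show "lamp_action (\<one>\<^bsub>wreath_base G H\<^esub>, \<one>\<^bsub>H\<^esub>) w = \<one>\<^bsub>BijGroup configurations\<^esub> w"
  proof (cases "w \<in> configurations")
    case True
    then obtain \<phi> b where w: "w = (\<phi>, b)" "\<phi> \<in> B \<rightarrow>\<^sub>E A" "b \<in> B"
      by (auto simp: configurations_def)
    have "(\<lambda>c\<in>B. \<theta> \<one>\<^bsub>G\<^esub> (\<phi> c)) = \<phi>"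
    proof
      fix c
      show "(\<lambda>c\<in>B. \<theta> \<one>\<^bsub>G\<^esub> (\<phi> c)) c = \<phi> c"
        using \<theta>D(5)[OF PiE_mem[OF w(2)]] PiE_arb[OF w(2)] by (cases "c \<in> B") simp_all
    qed
    then have "lamp_action (\<one>\<^bsub>wreath_base G H\<^esub>, \<one>\<^bsub>H\<^esub>) (\<phi>, b) = (\<phi>, b)"
      by (simp only: lamp_action_apply[OF w(2,3)] lamp_one \<sigma>D(5)[OF w(3)])
    then show ?thesis using True w(1) by (simp add: BijGroup_def del: one_sum_group)
  qed (simp add: lamp_action_def BijGroup_def)
qed

section \<open>Most positions are clear\<close>

text \<open>There is one term for each instance of multiplicativity and one for each instance of freeness
  that a regular place has to satisfy.\<close>

definition defect :: real
  where "defect = (real (card L) * real (card L) + real (card L)) * \<eta>"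

lemma card_irregular: "real (card {c \<in> B. \<not> regular c}) \<le> defect * real (card B)"
proof -
  let ?M = "\<lambda>(x, y). {c \<in> B. \<sigma> (x \<otimes>\<^bsub>H\<^esub> y) c \<noteq> \<sigma> x (\<sigma> y c)}" and ?Z = "\<lambda>z. {c \<in> B. \<sigma> z c = c}"
  have "{c \<in> B. \<not> regular c} = (\<Union>p\<in>L \<times> L. ?M p) \<union> (\<Union>z\<in>L - {\<one>\<^bsub>H\<^esub>}. ?Z z)"
    by (auto simp: regular_def)
  then have "card {c \<in> B. \<not> regular c} \<le> (\<Sum>p\<in>L \<times> L. card (?M p)) + (\<Sum>z\<in>L - {\<one>\<^bsub>H\<^esub>}. card (?Z z))"
    using card_Un_le[of "\<Union>p\<in>L \<times> L. ?M p" "\<Union>z\<in>L - {\<one>\<^bsub>H\<^esub>}. ?Z z"]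
      card_UN_le[of "L \<times> L" ?M] card_UN_le[of "L - {\<one>\<^bsub>H\<^esub>}" ?Z] L(2) by simp
  then have "real (card {c \<in> B. \<not> regular c})
      \<le> (\<Sum>p\<in>L \<times> L. real (card (?M p))) + (\<Sum>z\<in>L - {\<one>\<^bsub>H\<^esub>}. real (card (?Z z)))"
    by (simp flip: of_nat_sum of_nat_add)
  also have "\<dots> \<le> (\<Sum>p\<in>L \<times> L. \<eta> * real (card B)) + (\<Sum>z\<in>L - {\<one>\<^bsub>H\<^esub>}. \<eta> * real (card B))"
    using sofic_approximation_almost_mult[OF approx_H L(1)] sofic_approximation_almost_free[OF approx_H]
    by (intro add_mono sum_mono) (auto simp: less_imp_le)
  also have "\<dots> \<le> (\<Sum>p\<in>L \<times> L. \<eta> * real (card B)) + (\<Sum>z\<in>L. \<eta> * real (card B))"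
    using L(2) \<eta> by (intro add_left_mono sum_mono2) auto
  also have "\<dots> = defect * real (card B)"
    by (simp add: defect_def card_cartesian_product algebra_simps)
  finally show ?thesis .
qed

text \<open>A position that is not clear is the image of an irregular place under \<^term>\<open>\<sigma> x\<close>
  for some \<^term>\<open>x\<close> in \<^term>\<open>E\<close>.\<close>

lemma card_not_clear: "real (card {b \<in> B. \<not> clear b}) \<le> real (card E) * defect * real (card B)"
proof -
  let ?I = "{c \<in> B. \<not> regular c}"
  have fI: "finite ?I" using \<sigma>D(1) by simp
  have "{b \<in> B. \<not> clear b} \<subseteq> (\<Union>x\<in>E. \<sigma> x ` ?I)" by (auto simp: clear_def)
  then have "card {b \<in> B. \<not> clear b} \<le> card (\<Union>x\<in>E. \<sigma> x ` ?I)"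
    using E_finite fI by (intro card_mono) auto
  also have "\<dots> \<le> (\<Sum>x\<in>E. card (\<sigma> x ` ?I))" using E_finite by (rule card_UN_le)
  also have "\<dots> \<le> (\<Sum>x\<in>E. card ?I)" by (intro sum_mono card_image_le fI)
  finally have "card {b \<in> B. \<not> clear b} \<le> card E * card ?I" by simp
  then have "real (card {b \<in> B. \<not> clear b}) \<le> real (card E) * real (card ?I)"
    by (simp flip: of_nat_mult)
  also have "\<dots> \<le> real (card E) * (defect * real (card B))"
    by (intro mult_left_mono card_irregular) simp
  finally show ?thesis by (simp add: mult.assoc)
qed

lemma card_moved_not_clear:
  assumes "h \<in> carrier H"
  shows "card {b \<in> B. \<not> clear (\<sigma> h b)} \<le> card {b \<in> B. \<not> clear b}"
proof -
  have "{b \<in> B. \<not> clear (\<sigma> h b)} = {b \<in> B. \<sigma> h b \<in> {b \<in> B. \<not> clear b}}"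
    using assms \<sigma>_in by auto
  then show ?thesis
    using card_inj_preimage_le[of B "\<sigma> h" "{b \<in> B. \<not> clear b}"] \<sigma>D(1) \<sigma>D(4)[OF assms]
    by (simp add: bij_betw_def)
qed

lemma card_reachable_le:
  assumes "b \<in> B"
  shows "card {c \<in> B. \<exists>x\<in>E. \<sigma> x c = b} \<le> card E"
proof -
  have "the_inv_into B (\<sigma> x) (\<sigma> x c) = c" if "x \<in> E" "c \<in> B" for x c
    using that \<sigma>D(4)[OF E_carrier] the_inv_into_f_f by (metis bij_betw_def)
  then have "{c \<in> B. \<exists>x\<in>E. \<sigma> x c = b} \<subseteq> (\<lambda>x. the_inv_into B (\<sigma> x) b) ` E"
    by (auto intro!: image_eqI)
  then show ?thesis using E_finite by (rule surj_card_le[rotated])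
qed

lemma defect_nonneg: "defect \<ge> 0"
  using \<eta> by (simp add: defect_def)

section \<open>The lamp action is almost multiplicative and almost free\<close>

lemma controlled_lamp:
  assumes "controlled (g, h)"
  shows "lamp g c b = \<one>\<^bsub>G\<^esub> \<or> lamp g c b \<in> P"
  using assms by (cases rule: lamp_cases[of c b]) (auto simp: controlled_def E_carrier)

text \<open>Except for a small set of positions of the walker, the action fails to be multiplicative only
  through \<^term>\<open>\<theta>\<close>, and only at a lamp within reach of the final position: at every
  other lamp both factors act by \<open>\<theta> 1\<close>, which is the identity.\<close>

lemma lamp_action_almost_mult:
  assumes gh: "controlled (g, h)" and gh': "controlled (g', h')"
    and shifted: "\<And>x. x \<in> carrier H \<Longrightarrow> g' x \<noteq> \<one>\<^bsub>G\<^esub> \<Longrightarrow> h \<otimes>\<^bsub>H\<^esub> x \<in> E"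
  shows "real (card {w \<in> configurations.
      lamp_action ((g, h) \<otimes>\<^bsub>wreath_product G H\<^esub> (g', h')) w \<noteq> lamp_action (g, h) (lamp_action (g', h') w)})
    \<le> ((2 * real (card E) + 1) * defect + real (card E) * \<delta>) * real (card configurations)"
    (is "real (card ?S) \<le> _")
proof -
  have g: "g \<in> carrier (wreath_base G H)" "g' \<in> carrier (wreath_base G H)"
    and hL: "h \<in> L" "h' \<in> L" and h: "h \<in> carrier H" "h' \<in> carrier H"
    using gh gh' L by (auto simp: controlled_def)
  \<comment> \<open>Regularity of the starting point makes the walker arrive at the same place both times, and
    the two clearness conditions make the shift rule applicable to its second step.\<close>
  define D where "D = {b \<in> B. \<not> regular b} \<union> {b \<in> B. \<not> clear (\<sigma> h' b)} \<union> {b \<in> B. \<not> clear (\<sigma> (h \<otimes>\<^bsub>H\<^esub> h') b)}"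
  have "card D \<le> card {b \<in> B. \<not> regular b} + card {b \<in> B. \<not> clear (\<sigma> h' b)} + card {b \<in> B. \<not> clear (\<sigma> (h \<otimes>\<^bsub>H\<^esub> h') b)}"
    unfolding D_def by (meson add_right_mono card_Un_le le_trans)
  also have "\<dots> \<le> card {b \<in> B. \<not> regular b} + card {b \<in> B. \<not> clear b} + card {b \<in> B. \<not> clear b}"
    using h by (intro add_mono card_moved_not_clear) auto
  finally have "real (card D) \<le> real (card {b \<in> B. \<not> regular b}) + real (card {b \<in> B. \<not> clear b}) + real (card {b \<in> B. \<not> clear b})"
    by (simp flip: of_nat_add)
  also have "\<dots> \<le> (2 * real (card E) + 1) * defect * real (card B)"
    using card_irregular card_not_clear by (simp add: algebra_simps)
  finally have D_small: "real (card D) \<le> (2 * real (card E) + 1) * defect * real (card B)" .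
  have fibre: "real (card {\<phi> \<in> B \<rightarrow>\<^sub>E A. (\<phi>, b) \<in> ?S}) \<le> real (card E) * \<delta> * real (card (B \<rightarrow>\<^sub>E A))"
    if b: "b \<in> B - D" for b
  proof -
    define b1 b2 where "b1 = \<sigma> h' b" and "b2 = \<sigma> h b1"
    have b12: "b1 \<in> B" "b2 \<in> B" using b h by (auto simp: b1_def b2_def \<sigma>_in)
    have hh: "\<sigma> (h \<otimes>\<^bsub>H\<^esub> h') b = b2"
      using b hL by (auto simp: D_def regular_def b1_def b2_def)
    have clear: "clear b1" "clear b2" using b hh by (auto simp: D_def b1_def)
    let ?C = "{c \<in> B. \<exists>x\<in>E. \<sigma> x c = b2}"
    define T where "T c = (if lamp g c b2 \<in> P \<and> lamp g' c b1 \<in> P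
      then {a \<in> A. \<theta> (lamp g c b2 \<otimes>\<^bsub>G\<^esub> lamp g' c b1) a \<noteq> \<theta> (lamp g c b2) (\<theta> (lamp g' c b1) a)} else {})" for c
    have T: "T c \<subseteq> A" "real (card (T c)) \<le> \<delta> * real (card A)" for c
      using sofic_approximation_almost_mult[OF approx_G P, of "lamp g c b2" "lamp g' c b1"] \<delta>
      unfolding T_def by (auto simp: less_imp_le)
    have shift: "lamp (wreath_shift G H h g') c b2 = lamp g' c b1" if "c \<in> B" for c
      unfolding b2_def using gh' hL g b12 clear that shifted
      by (intro lamp_shift) (auto simp: controlled_def b2_def)
    have "{\<phi> \<in> B \<rightarrow>\<^sub>E A. (\<phi>, b) \<in> ?S} \<subseteq> {\<phi> \<in> B \<rightarrow>\<^sub>E A. \<exists>c\<in>?C. \<phi> c \<in> T c}"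
    proof
      fix \<phi> assume "\<phi> \<in> {\<phi> \<in> B \<rightarrow>\<^sub>E A. (\<phi>, b) \<in> ?S}"
      then have \<phi>: "\<phi> \<in> B \<rightarrow>\<^sub>E A"
        and ne: "lamp_action ((g, h) \<otimes>\<^bsub>wreath_product G H\<^esub> (g', h')) (\<phi>, b) \<noteq> lamp_action (g, h) (lamp_action (g', h') (\<phi>, b))"
        by simp_all
      let ?\<psi> = "\<lambda>c\<in>B. \<theta> (lamp g' c b1) (\<phi> c)"
      have bB: "b \<in> B" using b by blast
      have \<psi>: "?\<psi> \<in> B \<rightarrow>\<^sub>E A" using \<phi> g by (auto intro!: \<theta>_in lamp_closed)
      have "lamp_action ((g, h) \<otimes>\<^bsub>wreath_product G H\<^esub> (g', h')) (\<phi>, b)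
          = ((\<lambda>c\<in>B. \<theta> (lamp g c b2 \<otimes>\<^bsub>G\<^esub> lamp g' c b1) (\<phi> c)), b2)"
        using \<phi> bB by (auto simp: wreath_mult lamp_action_apply hh lamp_mult shift
            simp del: mult_sum_group intro!: restrict_ext)
      moreover have "lamp_action (g, h) (lamp_action (g', h') (\<phi>, b))
          = ((\<lambda>c\<in>B. \<theta> (lamp g c b2) (\<theta> (lamp g' c b1) (\<phi> c))), b2)"
        using \<phi> \<psi> bB b12 by (auto simp: lamp_action_apply b1_def[symmetric] b2_def[symmetric]
            intro!: restrict_ext)
      ultimately obtain c where c: "c \<in> B"
        and cne: "\<theta> (lamp g c b2 \<otimes>\<^bsub>G\<^esub> lamp g' c b1) (\<phi> c) \<noteq> \<theta> (lamp g c b2) (\<theta> (lamp g' c b1) (\<phi> c))"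
        using ne by (metis (no_types, lifting) restrict_ext)
      have \<phi>c: "\<phi> c \<in> A" using \<phi> c by auto
      have lc: "lamp g c b2 \<in> carrier G" "lamp g' c b1 \<in> carrier G" using g by (auto intro: lamp_closed)
      have n1: "lamp g c b2 \<noteq> \<one>\<^bsub>G\<^esub>" "lamp g' c b1 \<noteq> \<one>\<^bsub>G\<^esub>"
        using cne lc \<phi>c by (auto simp: \<theta>D(5) \<theta>_in)
      then have "lamp g c b2 \<in> P" "lamp g' c b1 \<in> P"
        using controlled_lamp[OF gh] controlled_lamp[OF gh'] by blast+
      moreover have "\<exists>x\<in>E. \<sigma> x c = b2"
        using n1(1) by (cases rule: lamp_cases[of c b2]) auto
      ultimately have "c \<in> ?C" "\<phi> c \<in> T c" using c cne \<phi>c by (auto simp: T_def)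
      then show "\<phi> \<in> {\<phi> \<in> B \<rightarrow>\<^sub>E A. \<exists>c\<in>?C. \<phi> c \<in> T c}" using \<phi> by blast
    qed
    then have "real (card {\<phi> \<in> B \<rightarrow>\<^sub>E A. (\<phi>, b) \<in> ?S}) \<le> real (card {\<phi> \<in> B \<rightarrow>\<^sub>E A. \<exists>c\<in>?C. \<phi> c \<in> T c})"
      using \<theta>D(1) \<sigma>D(1) by (intro of_nat_mono card_mono) (auto simp: finite_PiE)
    also have "\<dots> \<le> real (card ?C) * \<delta> * real (card (B \<rightarrow>\<^sub>E A))"
      by (rule card_PiE_some_coordinate[OF \<theta>D(1,2) \<sigma>D(1)]) (auto intro: T(2) T(1)[THEN subsetD])
    also have "\<dots> \<le> real (card E) * \<delta> * real (card (B \<rightarrow>\<^sub>E A))"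
      using \<delta> card_reachable_le[OF b12(2)] by (intro mult_right_mono) auto
    finally show ?thesis .
  qed
  show ?thesis unfolding configurations_def
  proof (rule card_fibrewise_le[OF _ \<sigma>D(1) _ _ D_small])
    show "finite (B \<rightarrow>\<^sub>E A)" using \<theta>D(1) \<sigma>D(1) by (simp add: finite_PiE)
  qed (use fibre \<delta> in \<open>auto simp: D_def configurations_def\<close>)
qed

text \<open>Either the walker moves, or the walker stays and some lamp within reach is subject to a
  nontrivial coordinate of \<^term>\<open>g\<close>, which changes most of its states.\<close>

lemma lamp_action_almost_free:
  assumes gh: "controlled (g, h)" and ne: "(g, h) \<noteq> \<one>\<^bsub>wreath_product G H\<^esub>"
  shows "real (card {w \<in> configurations. lamp_action (g, h) w = w})
    \<le> ((real (card E) + 1) * defect + \<delta>) * real (card configurations)"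
    (is "real (card ?S) \<le> _")
proof -
  have g: "g \<in> carrier (wreath_base G H)" and hL: "h \<in> L" and h: "h \<in> carrier H"
    using gh L by (auto simp: controlled_def)
  define D where "D = {b \<in> B. \<not> regular b} \<union> {b \<in> B. \<not> clear b}"
  have "card D \<le> card {b \<in> B. \<not> regular b} + card {b \<in> B. \<not> clear b}"
    unfolding D_def by (rule card_Un_le)
  then have "real (card D) \<le> real (card {b \<in> B. \<not> regular b}) + real (card {b \<in> B. \<not> clear b})"
    by (simp flip: of_nat_add)
  also have "\<dots> \<le> (real (card E) + 1) * defect * real (card B)"
    using card_irregular card_not_clear by (simp add: algebra_simps)
  finally have D_small: "real (card D) \<le> (real (card E) + 1) * defect * real (card B)" .
  have fibre: "real (card {\<phi> \<in> B \<rightarrow>\<^sub>E A. (\<phi>, b) \<in> ?S}) \<le> \<delta> * real (card (B \<rightarrow>\<^sub>E A))"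
    if b: "b \<in> B - D" for b
  proof (cases "h = \<one>\<^bsub>H\<^esub>")
    case False
    then have "\<sigma> h b \<noteq> b" using b hL by (auto simp: D_def regular_def)
    then have "{\<phi> \<in> B \<rightarrow>\<^sub>E A. (\<phi>, b) \<in> ?S} = {}" using b by (auto simp: lamp_action_apply)
    then show ?thesis using \<delta> by (simp only: card.empty) simp
  next
    case True
    then have "g \<noteq> \<one>\<^bsub>wreath_base G H\<^esub>" using ne by (simp add: wreath_one)
    then obtain x where x: "x \<in> carrier H" "g x \<noteq> \<one>\<^bsub>G\<^esub>"
      using g by (auto simp: wreath_base_carrier[OF G.is_group] fun_eq_iff restrict_def PiE_iff extensional_def)
        metis
    then have xE: "x \<in> E" "g x \<in> P" using gh by (auto simp: controlled_def)
    obtain c where c: "c \<in> B" "\<sigma> x c = b" 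
      using bij_betw_imp_surj_on[OF \<sigma>D(4)[OF x(1)]] b by (metis DiffD1 imageE)
    have lamp: "lamp g c b = g x" using b xE c by (intro lamp_clear) (auto simp: D_def)
    have "{\<phi> \<in> B \<rightarrow>\<^sub>E A. (\<phi>, b) \<in> ?S} \<subseteq> {\<phi> \<in> B \<rightarrow>\<^sub>E A. \<exists>c'\<in>{c}. \<phi> c' \<in> {a \<in> A. \<theta> (g x) a = a}}"
    proof
      fix \<phi> assume "\<phi> \<in> {\<phi> \<in> B \<rightarrow>\<^sub>E A. (\<phi>, b) \<in> ?S}"
      then have \<phi>: "\<phi> \<in> B \<rightarrow>\<^sub>E A" and fixed: "lamp_action (g, h) (\<phi>, b) = (\<phi>, b)"
        by simp_all
      have "(\<lambda>c\<in>B. \<theta> (lamp g c b) (\<phi> c)) = \<phi>"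
        using fixed \<phi> b True by (simp add: lamp_action_apply \<sigma>D(5))
      then have "\<theta> (lamp g c b) (\<phi> c) = \<phi> c" using c by (metis restrict_apply')
      then show "\<phi> \<in> {\<phi> \<in> B \<rightarrow>\<^sub>E A. \<exists>c'\<in>{c}. \<phi> c' \<in> {a \<in> A. \<theta> (g x) a = a}}"
        using lamp \<phi> c by auto
    qed
    then have "real (card {\<phi> \<in> B \<rightarrow>\<^sub>E A. (\<phi>, b) \<in> ?S})
        \<le> real (card {\<phi> \<in> B \<rightarrow>\<^sub>E A. \<exists>c'\<in>{c}. \<phi> c' \<in> {a \<in> A. \<theta> (g x) a = a}})"
      using \<theta>D(1) \<sigma>D(1) by (intro of_nat_mono card_mono) (auto simp: finite_PiE)
    also have "\<dots> \<le> real (card {c}) * \<delta> * real (card (B \<rightarrow>\<^sub>E A))"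
      using sofic_approximation_almost_free[OF approx_G xE(2) x(2)] c \<theta>D(1,2) \<sigma>D(1)
      by (intro card_PiE_some_coordinate) (auto simp: less_imp_le)
    finally show ?thesis by simp
  qed
  show ?thesis unfolding configurations_def
  proof (rule card_fibrewise_le[OF _ \<sigma>D(1) _ _ D_small])
    show "finite (B \<rightarrow>\<^sub>E A)" using \<theta>D(1) \<sigma>D(1) by (simp add: finite_PiE)
  qed (use fibre \<delta> in \<open>auto simp: D_def configurations_def\<close>)
qed

lemma lamp_action_sofic_approximation:
  assumes controlled: "\<And>w. w \<in> F \<Longrightarrow> controlled w"
    and shifted: "\<And>g h g' h' x. (g, h) \<in> F \<Longrightarrow> (g', h') \<in> F \<Longrightarrow> x \<in> carrier H \<Longrightarrow> g' x \<noteq> \<one>\<^bsub>G\<^esub> \<Longrightarrow> h \<otimes>\<^bsub>H\<^esub> x \<in> E"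
    and small: "(2 * real (card E) + 1) * defect + (real (card E) + 1) * \<delta> < \<epsilon>"
  shows "sofic_approximation (wreath_product G H) F \<epsilon> configurations lamp_action"
proof -
  interpret W: group "wreath_product G H"
    by (rule group_wreath_product) (rule G.is_group H.is_group)+
  note dist = hamming_dist_less_iff[OF configurations_finite configurations_nonempty]
    hamming_length_greater_iff[OF configurations_finite configurations_nonempty]
  have pos: "real (card configurations) > 0"
    using configurations_finite configurations_nonempty by (simp add: card_gt_0_iff)
  have act: "lamp_action w \<in> carrier (BijGroup configurations)" if "w \<in> carrier (wreath_product G H)" for w
    using that lamp_action_bij by (auto simp: wreath_carrier)
  have F: "w \<in> carrier (wreath_product G H)" if "w \<in> F" for w
    using controlled[OF that] L by (auto simp: wreath_carrier controlled_def)
  have "hamming_dist configurations (lamp_action (v \<otimes>\<^bsub>wreath_product G H\<^esub> w))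
      (lamp_action v \<otimes>\<^bsub>BijGroup configurations\<^esub> lamp_action w) < \<epsilon>" if v: "v \<in> F" and w: "w \<in> F" for v w
  proof -
    obtain g h g' h' where vw: "v = (g, h)" "w = (g', h')" by fastforce
    let ?S = "{u \<in> configurations. lamp_action (v \<otimes>\<^bsub>wreath_product G H\<^esub> w) u \<noteq> lamp_action v (lamp_action w u)}"
    have "real (card ?S) \<le> ((2 * real (card E) + 1) * defect + real (card E) * \<delta>) * real (card configurations)"
      using v w controlled shifted unfolding vw by (intro lamp_action_almost_mult) blast+
    also have "\<dots> < \<epsilon> * real (card configurations)"
      using small \<delta> pos by (intro mult_strict_right_mono) (auto simp: algebra_simps)
    also have "?S = {u \<in> configurations. lamp_action (v \<otimes>\<^bsub>wreath_product G H\<^esub> w) u \<noteq> (lamp_action v \<otimes>\<^bsub>BijGroup configurations\<^esub> lamp_action w) u}"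
      using BijGroup_mult_apply[OF act[OF F[OF v]] act[OF F[OF w]]] by auto
    finally show ?thesis by (simp add: dist)
  qed
  moreover have "hamming_length configurations (lamp_action v) > 1 - \<epsilon>"
    if v: "v \<in> F" "v \<noteq> \<one>\<^bsub>wreath_product G H\<^esub>" for v
  proof -
    have "real (card {u \<in> configurations. lamp_action v u = u}) \<le> ((real (card E) + 1) * defect + \<delta>) * real (card configurations)"
      using v controlled[OF v(1)] lamp_action_almost_free by (cases v) auto
    also have "\<dots> < \<epsilon> * real (card configurations)"
    proof (rule mult_strict_right_mono[OF _ pos])
      have "(real (card E) + 1) * defect + \<delta> \<le> (2 * real (card E) + 1) * defect + (real (card E) + 1) * \<delta>"
        using \<delta> defect_nonneg by (simp add: algebra_simps)
      then show "(real (card E) + 1) * defect + \<delta> < \<epsilon>" using small by linarith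
    qed
    finally show ?thesis by (simp add: dist)
  qed
  ultimately show ?thesis
    using configurations_finite configurations_nonempty act lamp_action_one
    by (simp add: sofic_approximation_def wreath_one del: one_sum_group)
qed

end

section \<open>Wreath products of sofic groups\<close>

theorem theorem1:
  fixes G :: "('g, 'p) monoid_scheme" and H :: "('h, 'q) monoid_scheme"
  assumes "group G" and "countable (carrier G)" and "sofic G"
    and "group H" and "countable (carrier H)" and "sofic H"
  shows "sofic (wreath_product G H)"
  unfolding sofic_def
proof (intro allI impI, elim conjE)
  fix F :: "(('h \<Rightarrow> 'g) \<times> 'h) set" and \<epsilon> :: real
  assume F: "finite F" "F \<subseteq> carrier (wreath_product G H)" and \<epsilon>: "\<epsilon> > 0"
  interpret G: group G by fact
  interpret H: group H by fact
  define supp where "supp g = {x \<in> carrier H. g x \<noteq> \<one>\<^bsub>G\<^esub>}" for g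
  have F_base: "g \<in> carrier (wreath_base G H)" "h \<in> carrier H" if "(g, h) \<in> F" for g h
    using F that by (auto simp: wreath_carrier)
  have supp_finite: "finite (supp g)" if "(g, h) \<in> F" for g h
    using F_base[OF that] by (simp add: wreath_base_carrier[OF \<open>group G\<close>] supp_def)
  \<comment> \<open>Besides the supports, \<open>E\<close> has to contain their translates, because the product of two elements
    of \<open>F\<close> involves a shifted base element.\<close>
  define K where "K = (\<Union>(g, h)\<in>F. supp g)"
  define E where "E = K \<union> (\<lambda>(h, x). h \<otimes>\<^bsub>H\<^esub> x) ` (snd ` F \<times> K)"
  define L where "L = snd ` F \<union> E \<union> (\<lambda>(x, y). inv\<^bsub>H\<^esub> x \<otimes>\<^bsub>H\<^esub> y) ` (E \<times> E)"
  define P where "P = (\<Union>(g, h)\<in>F. g ` supp g)"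
  have K: "finite K" "K \<subseteq> carrier H" using F supp_finite by (auto simp: K_def supp_def)
  have E: "finite E" "E \<subseteq> carrier H" using F K F_base by (auto simp: E_def)
  have L: "finite L" "L \<subseteq> carrier H" using F E F_base by (auto simp: L_def)
  have P: "finite P" using F supp_finite by (auto simp: P_def)
  have P': "P \<subseteq> carrier G"
    using F_base(1) by (fastforce simp: P_def supp_def wreath_base_carrier[OF \<open>group G\<close>])
  \<comment> \<open>Up to the summand \<open>1\<close>, which only makes it positive, \<open>M\<close> is the factor by which the error of
    the approximation of \<open>H\<close> is amplified; \<open>card E + 1\<close> is the factor for \<open>G\<close>.\<close>
  define M where "M = (2 * real (card E) + 1) * (real (card L) * real (card L) + real (card L)) + 1"
  define \<eta> where "\<eta> = \<epsilon> / (3 * M)"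
  define \<delta> where "\<delta> = \<epsilon> / (3 * (real (card E) + 1))"
  have M: "M > 0" unfolding M_def by (intro add_nonneg_pos mult_nonneg_nonneg) auto
  have \<eta>: "\<eta> > 0" using \<epsilon> M by (simp add: \<eta>_def)
  have \<delta>: "\<delta> > 0" using \<epsilon> by (auto simp: \<delta>_def intro!: divide_pos_pos)
  obtain A :: "nat set" and \<theta> where \<theta>: "sofic_approximation G P \<delta> A \<theta>"
    using \<open>sofic G\<close> P P' \<delta> unfolding sofic_def by blast
  obtain B :: "nat set" and \<sigma> where \<sigma>: "sofic_approximation H L \<eta> B \<sigma>"
    using \<open>sofic H\<close> L \<eta> unfolding sofic_def by blast
  interpret lamplighter G H P \<delta> A \<theta> L \<eta> B \<sigma> E
    by unfold_locales (use \<theta> \<sigma> P' L \<eta> \<delta> in \<open>auto simp: L_def\<close>)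
  have "sofic_approximation (wreath_product G H) F \<epsilon> configurations lamp_action"
  proof (rule lamp_action_sofic_approximation)
    fix w assume "w \<in> F"
    then obtain g h where gh: "w = (g, h)" "(g, h) \<in> F" by (cases w) auto
    have "h \<in> L" using gh(2) by (force simp: L_def)
    moreover have "x \<in> E" "g x \<in> P" if "x \<in> carrier H" "g x \<noteq> \<one>\<^bsub>G\<^esub>" for x
    proof -
      have "x \<in> supp g" using that by (simp add: supp_def)
      then show "x \<in> E" "g x \<in> P" using gh(2) by (auto simp: E_def K_def P_def)
    qed
    ultimately show "controlled w" using F_base(1) gh by (auto simp: controlled_def)
  next
    fix g h g' h' x
    assume "(g, h) \<in> F" "(g', h') \<in> F" "x \<in> carrier H" "g' x \<noteq> \<one>\<^bsub>G\<^esub>"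
    then have "h \<in> snd ` F" "x \<in> K" by (force simp: K_def supp_def)+
    then show "h \<otimes>\<^bsub>H\<^esub> x \<in> E" by (auto simp: E_def)
  next
    have "(2 * real (card E) + 1) * defect = (M - 1) * \<eta>"
      by (simp add: defect_def M_def)
    also have "\<dots> \<le> M * \<eta>" using \<eta> by (intro mult_right_mono) auto
    also have "\<dots> = \<epsilon> / 3" using M by (simp add: \<eta>_def)
    finally have "(2 * real (card E) + 1) * defect \<le> \<epsilon> / 3" .
    moreover have "(real (card E) + 1) * \<delta> = \<epsilon> / 3" 
      by (simp add: \<delta>_def field_simps add_nonneg_eq_0_iff)
    ultimately show "(2 * real (card E) + 1) * defect + (real (card E) + 1) * \<delta> < \<epsilon>"
      using \<epsilon> by linarith
  qed
  then show "\<exists>(A :: nat set) \<sigma>. sofic_approximation (wreath_product G H) F \<epsilon> A \<sigma>"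
    by (intro sofic_approximation_nat[OF group_wreath_product F(2)] \<open>group G\<close> \<open>group H\<close>)
qed

end
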